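(* Let $\Omega\subset\mathbb{R}^3$ be a bounded domain, placed in the smallest box $I=(0,l_1)\times(0,l_2)\times(0,l_3)$ as described in the context. Let $\phi=(\phi_1,\phi_2,\phi_3)\in\mathring{\mathsf R}_0(\Omega)$. Then for every permutation $(i,j,k)$ of $\{1,2,3\}$, all $0\le\alpha_j<\beta_j\le l_j$ and all $0\le\alpha_k<\beta_k\le l_k$, with $\Omega_{jk}=\{x\in\Omega\mid\alpha_j<x_j<\beta_j,\ \alpha_k<x_k<\beta_k\}$, one has $\phi_i\in\mathsf L^2_0(\Omega_{jk})$.
   Context: $\Omega$ is a bounded domain (open connected set) in $\mathbb{R}^3$; no boundary regularity is assumed. $\Omega$ is translated so that it is contained in the rectangular cuboid $I=(0,l_1)\times(0,l_2)\times(0,l_3)$, $0<l_1,l_2,l_3<\infty$, with $I$ as small as possible. For a bounded open set $\omega\subset\mathbb{R}^3$, $\mathsf L^2_0(\omega)=\{\varphi\in\mathsf L^2(\omega)\mid\int_\omega\varphi\,\mathrm{d}x=0\}$; a function on $\Omega$ is said to belong to $\mathsf L^2_0(\omega)$, $\omega\subset\Omega$, if its restriction to $\omega$ does. For a vector field $\phi$ the rotation is $\operatorname{rot}\phi=(\partial_2\phi_3-\partial_3\phi_2,\ \partial_3\phi_1-\partial_1\phi_3,\ \partial_1\phi_2-\partial_2\phi_1)$. $\mathsf R(\Omega)$ is the space of vector fields $\phi\in\mathsf L^2(\Omega)$ (with values in $\mathbb{R}^3$) whose weak rotation $\operatorname{rot}\phi$ belongs to $\mathsf L^2(\Omega)$.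 $\mathring{\mathsf R}(\Omega)$ is the closure in $\mathsf R(\Omega)$ of the smooth vector fields with compact support in $\Omega$, with respect to the graph norm $(|\phi|_{\mathsf L^2}^2+|\operatorname{rot}\phi|_{\mathsf L^2}^2)^{1/2}$, and $\mathring{\mathsf R}_0(\Omega)=\{\phi\in\mathring{\mathsf R}(\Omega)\mid\operatorname{rot}\phi=0\}$. *)

theory Defs
  imports "HOL-Analysis.Analysis"
begin

definition partial_deriv :: "3 \<Rightarrow> (real^3 \<Rightarrow> 'b::real_normed_vector) \<Rightarrow> real^3 \<Rightarrow> 'b" where
  "partial_deriv i f x = frechet_derivative f (at x) (axis i 1)"

text \<open>The index list is the multi-index: a function is smooth iff all its iterated partial
  derivatives exist and are (Frechet) differentiable everywhere; continuity of all of them follows.\<close>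

definition smooth :: "(real^3 \<Rightarrow> 'b::real_normed_vector) \<Rightarrow> bool" where
  "smooth f \<longleftrightarrow> (\<forall>is x. foldr partial_deriv is f differentiable (at x))"

definition rot :: "(real^3 \<Rightarrow> real^3) \<Rightarrow> real^3 \<Rightarrow> real^3" where
  "rot \<phi> x = vector
     [partial_deriv 2 (\<lambda>y. \<phi> y $ 3) x - partial_deriv 3 (\<lambda>y. \<phi> y $ 2) x,
      partial_deriv 3 (\<lambda>y. \<phi> y $ 1) x - partial_deriv 1 (\<lambda>y. \<phi> y $ 3) x,
      partial_deriv 1 (\<lambda>y. \<phi> y $ 2) x - partial_deriv 2 (\<lambda>y. \<phi> y $ 1) x]"

text \<open>Smooth fields with compact support in \<open>\<Omega>\<close>, extended by zero to the whole space.\<close>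

definition test_fields :: "(real^3) set \<Rightarrow> (real^3 \<Rightarrow> real^3) set" where
  "test_fields \<Omega> = {\<theta>. smooth \<theta> \<and> compact (closure {x. \<theta> x \<noteq> 0}) \<and> closure {x. \<theta> x \<noteq> 0} \<subseteq> \<Omega>}"

text \<open>Elements of the function spaces below are representatives: only the values almost
  everywhere on the underlying set matter, and the values outside of it are irrelevant.\<close>

definition L2 :: "(real^3) set \<Rightarrow> (real^3 \<Rightarrow> 'b::euclidean_space) set" where
  "L2 \<omega> = {f. f \<in> borel_measurable (lebesgue_on \<omega>) \<and>
               integrable (lebesgue_on \<omega>) (\<lambda>x. (norm (f x))\<^sup>2)}"

definition L2_norm :: "(real^3) set \<Rightarrow> (real^3 \<Rightarrow> 'b::euclidean_space) \<Rightarrow> real" where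
  "L2_norm \<omega> f = sqrt (\<integral>x. (norm (f x))\<^sup>2 \<partial>lebesgue_on \<omega>)"

definition L2_mean_zero :: "(real^3) set \<Rightarrow> (real^3 \<Rightarrow> real) set" where
  "L2_mean_zero \<omega> = {f \<in> L2 \<omega>. (\<integral>x. f x \<partial>lebesgue_on \<omega>) = 0}"

definition has_weak_rot :: "(real^3) set \<Rightarrow> (real^3 \<Rightarrow> real^3) \<Rightarrow> (real^3 \<Rightarrow> real^3) \<Rightarrow> bool" where
  "has_weak_rot \<Omega> \<phi> \<psi> \<longleftrightarrow>
     (\<forall>\<theta>\<in>test_fields \<Omega>.
        (\<integral>x. \<phi> x \<bullet> rot \<theta> x \<partial>lebesgue_on \<Omega>) = (\<integral>x. \<psi> x \<bullet> \<theta> x \<partial>lebesgue_on \<Omega>))"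

definition R_space :: "(real^3) set \<Rightarrow> (real^3 \<Rightarrow> real^3) set" where
  "R_space \<Omega> = {\<phi> \<in> L2 \<Omega>. \<exists>\<psi>\<in>L2 \<Omega>. has_weak_rot \<Omega> \<phi> \<psi>}"

text \<open>A representative of the weak rotation of a field in \<^term>\<open>R_space \<Omega>\<close>; for open \<open>\<Omega>\<close> it is
  unique up to null sets, so norms and almost-everywhere statements do not depend on the choice.\<close>

definition weak_rot :: "(real^3) set \<Rightarrow> (real^3 \<Rightarrow> real^3) \<Rightarrow> real^3 \<Rightarrow> real^3" where
  "weak_rot \<Omega> \<phi> = (SOME \<psi>. \<psi> \<in> L2 \<Omega> \<and> has_weak_rot \<Omega> \<phi> \<psi>)"

definition graph_norm :: "(real^3) set \<Rightarrow> (real^3 \<Rightarrow> real^3) \<Rightarrow> real" where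
  "graph_norm \<Omega> \<phi> = sqrt ((L2_norm \<Omega> \<phi>)\<^sup>2 + (L2_norm \<Omega> (weak_rot \<Omega> \<phi>))\<^sup>2)"

definition R_ring :: "(real^3) set \<Rightarrow> (real^3 \<Rightarrow> real^3) set" where
  "R_ring \<Omega> = {\<phi> \<in> R_space \<Omega>.
      \<forall>\<epsilon>>0. \<exists>\<theta>\<in>test_fields \<Omega>. graph_norm \<Omega> (\<lambda>x. \<phi> x - \<theta> x) < \<epsilon>}"

definition R_ring_0 :: "(real^3) set \<Rightarrow> (real^3 \<Rightarrow> real^3) set" where
  "R_ring_0 \<Omega> = {\<phi> \<in> R_ring \<Omega>. AE x in lebesgue_on \<Omega>. weak_rot \<Omega> \<phi> x = 0}"

definition smallest_box :: "(real^3) set \<Rightarrow> real^3 \<Rightarrow> bool" where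
  "smallest_box \<Omega> l \<longleftrightarrow>
     (\<forall>i. 0 < l $ i) \<and> \<Omega> \<subseteq> box 0 l \<and> (\<forall>a b. \<Omega> \<subseteq> box a b \<longrightarrow> box 0 l \<subseteq> box a b)"

end

theory Submission
  imports Defs
begin

text \<open>
  Write \<open>\<chi>(x)\<close> for the indicator of \<open>\<alpha>\<^sub>j < x\<^sub>j < \<beta>\<^sub>j, \<alpha>\<^sub>k < x\<^sub>k < \<beta>\<^sub>k\<close>. The field \<open>\<chi> e\<^sub>i\<close> is, up to sign,
  the rotation of \<open>h e\<^sub>k\<close>, where \<open>h(x)\<close> is the antiderivative of \<open>\<chi>\<close> with respect to \<open>x\<^sub>j\<close>: it
  does not depend on \<open>x\<^sub>i\<close>, so only \<open>\<partial>\<^sub>j h = \<chi>\<close> enters. For a smooth field \<open>\<theta>\<close> with compact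
  support in \<open>\<Omega>\<close>, integration by parts moves the rotation onto \<open>\<theta>\<close> and gives
  \<open>\<bar>\<integral> \<theta>\<^sub>i \<chi>\<bar> = \<bar>\<integral> (rot \<theta>)\<^sub>k h\<bar>\<close> (lemma \<open>integral_rot_ramp\<close>), which is at most
  \<open>\<parallel>rot \<theta>\<parallel> \<parallel>h\<parallel>\<close> in the \<open>L2\<close> norms of \<open>\<Omega>\<close>. No boundary condition on \<open>h\<close> is used, since \<open>\<theta>\<close> has
  compact support. If such fields \<open>\<theta>\<close> approximate \<open>\<phi>\<close> in the graph norm, then \<open>rot \<theta>\<close> tends to
  \<open>rot \<phi> = 0\<close> in \<open>L2\<close>, hence \<open>\<integral> \<phi>\<^sub>i \<chi> = lim \<integral> \<theta>\<^sub>i \<chi> = 0\<close>.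

  Two points need care. The weak rotation of \<open>\<phi> - \<theta>\<close> is an arbitrarily chosen representative;
  since \<open>rot \<theta>\<close> is itself a test field, testing with it bounds \<open>\<parallel>rot \<theta>\<parallel>\<close> by the norm of any
  representative, without the uniqueness of weak rotations (lemma \<open>L2_norm_rot_le\<close>).
  Integration by parts is derived from the translation invariance of Lebesgue measure: in
  \<open>\<integral> (f(x + t v) - f(x)) g(x) dx = \<integral> f(x) (g(x - t v) - g(x)) dx\<close> one divides by \<open>t\<close> and lets \<open>t\<close>
  tend to 0. The only regularity needed is that \<open>f\<close> and \<open>g\<close> are Lipschitz and almost everywhere
  differentiable in the direction \<open>v\<close>, which
  \<open>h\<close> satisfies for \<open>v = e\<^sub>j\<close> and \<open>v = e\<^sub>i\<close> although it jumps in the direction \<open>e\<^sub>k\<close>.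
\<close>

section \<open>Integration by parts in one direction\<close>

lemma integrable_mult_bounded_support:
  fixes f g :: "'a::euclidean_space \<Rightarrow> real"
  assumes [measurable]: "f \<in> borel_measurable borel" "g \<in> borel_measurable borel"
    and supp: "bounded {x. f x \<noteq> 0}"
    and f_bd: "\<And>x. \<bar>f x\<bar> \<le> F" and g_bd: "\<And>x. \<bar>g x\<bar> \<le> G"
  shows "integrable lborel (\<lambda>x. f x * g x)"
proof -
  obtain R where R: "\<And>x. f x \<noteq> 0 \<Longrightarrow> norm x \<le> R"
    using supp by (auto simp: bounded_iff)
  have F0: "F \<ge> 0"
    using f_bd[of 0] by linarith
  show ?thesis
  proof (rule Bochner_Integration.integrable_bound)
    show "integrable lborel (\<lambda>x. F * G * indicat_real (cball (0::'a) R) x)"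
      by (intro integrable_mult_right integrable_real_indicator emeasure_bounded_finite) auto
    show "AE x in lborel. norm (f x * g x) \<le> norm (F * G * indicat_real (cball 0 R) x)"
    proof (rule AE_I2)
      fix x
      have "\<bar>f x\<bar> * \<bar>g x\<bar> \<le> F * G"
        using f_bd[of x] g_bd[of x] F0 by (intro mult_mono) auto
      then show "norm (f x * g x) \<le> norm (F * G * indicat_real (cball 0 R) x)"
        using R[of x] abs_ge_self[of "F * G"] by (cases "f x = 0") (auto simp: abs_mult)
    qed
  qed measurable
qed

text \<open>The functions need only be differentiable along the lines in direction \<open>v\<close>, and only almost
  everywhere; the Lipschitz bounds along these lines dominate the difference quotients.\<close>

lemma integration_by_parts_directional:
  fixes f g f' g' :: "'a::euclidean_space \<Rightarrow> real" and v :: 'a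
  assumes [measurable]: "f \<in> borel_measurable borel" "g \<in> borel_measurable borel"
      "f' \<in> borel_measurable borel" "g' \<in> borel_measurable borel"
    and supp: "bounded {x. f x \<noteq> 0}"
    and f_bd: "\<And>x. \<bar>f x\<bar> \<le> F" and g_bd: "\<And>x. \<bar>g x\<bar> \<le> G"
    and f_lip: "\<And>x t. \<bar>f (x + t *\<^sub>R v) - f x\<bar> \<le> K * \<bar>t\<bar>"
    and g_lip: "\<And>x t. \<bar>g (x + t *\<^sub>R v) - g x\<bar> \<le> L * \<bar>t\<bar>"
    and f': "AE x in lborel. ((\<lambda>t. f (x + t *\<^sub>R v)) has_real_derivative f' x) (at 0)"
    and g': "AE x in lborel. ((\<lambda>t. g (x + t *\<^sub>R v)) has_real_derivative g' x) (at 0)"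
  shows "(\<integral>x. f' x * g x \<partial>lborel) = - (\<integral>x. f x * g' x \<partial>lborel)"
proof -
  obtain R where R: "\<And>x. f x \<noteq> 0 \<Longrightarrow> norm x \<le> R"
    using supp by (auto simp: bounded_iff)
  define t :: "nat \<Rightarrow> real" where "t n = 1 / real (Suc n)" for n
  have t_pos: "t n > 0" and t_le: "t n \<le> 1" for n
    by (auto simp: t_def)
  have t_lim: "t \<longlonglongrightarrow> 0"
    unfolding t_def using LIMSEQ_inverse_real_of_nat by (simp add: inverse_eq_divide)
  have t_at: "filterlim t (at 0) sequentially"
    using t_lim t_pos by (auto simp: filterlim_at less_imp_neq intro!: always_eventually) (metis less_irrefl)
  have mt_at: "filterlim (\<lambda>n. - t n) (at 0) sequentially"
    using tendsto_minus[OF t_lim] t_pos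
    by (auto simp: filterlim_at less_imp_neq intro!: always_eventually) (metis less_irrefl)
  \<comment> \<open>All steps \<open>t n\<close> are at most 1, so \<open>B\<close> contains the supports of \<open>f\<close> and of all its translates.\<close>
  define B where "B = cball (0::'a) (R + norm v)"
  have B_int: "integrable lborel (\<lambda>x. c * indicator B x :: real)" for c
    unfolding B_def
    by (intro integrable_mult_right integrable_real_indicator emeasure_bounded_finite) auto
  have B_in: "x \<in> B" if "f x \<noteq> 0" for x
    using R[OF that] by (simp add: B_def add_increasing2)
  have B_in': "x \<in> B" if "f (x + t n *\<^sub>R v) \<noteq> 0" for x n
  proof -
    have "norm x \<le> norm (x + t n *\<^sub>R v) + norm (t n *\<^sub>R v)"
      by (metis add_diff_cancel_right' norm_triangle_ineq4)
    also have "norm (t n *\<^sub>R v) \<le> norm v"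
      using t_pos[of n] t_le[of n] by (simp add: mult_left_le_one_le)
    finally show ?thesis
      using R[OF that] by (simp add: B_def)
  qed
  have F0: "F \<ge> 0" using f_bd[of 0] by linarith
  have K0: "K \<ge> 0" using f_lip[of 0 1] by auto
  have lim1: "(\<lambda>n. \<integral>x. (f (x + t n *\<^sub>R v) - f x) / t n * g x \<partial>lborel)
      \<longlonglongrightarrow> (\<integral>x. f' x * g x \<partial>lborel)"
  proof (rule integral_dominated_convergence[where w = "\<lambda>x. (K * G) * indicator B x"])
    show "AE x in lborel. (\<lambda>n. (f (x + t n *\<^sub>R v) - f x) / t n * g x) \<longlonglongrightarrow> f' x * g x"
      using f'
    proof eventually_elim
      case (elim x)
      have "((\<lambda>h. (f (x + h *\<^sub>R v) - f x) / h) \<longlongrightarrow> f' x) (at 0)"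
        using elim by (simp add: has_field_derivative_iff)
      from filterlim_compose[OF this t_at] show ?case
        by (intro tendsto_mult tendsto_const) (simp add: o_def)
    qed
    show "AE x in lborel. norm ((f (x + t n *\<^sub>R v) - f x) / t n * g x) \<le> K * G * indicator B x" for n
    proof (rule AE_I2)
      fix x
      show "norm ((f (x + t n *\<^sub>R v) - f x) / t n * g x) \<le> K * G * indicator B x"
      proof (cases "x \<in> B")
        case True
        have "\<bar>f (x + t n *\<^sub>R v) - f x\<bar> / t n \<le> K"
          using f_lip[of x "t n"] t_pos[of n] by (simp add: divide_le_eq)
        then have "\<bar>f (x + t n *\<^sub>R v) - f x\<bar> / t n * \<bar>g x\<bar> \<le> K * G"
          using g_bd[of x] K0 by (intro mult_mono) auto
        then show ?thesis
          using True t_pos[of n] by (simp add: abs_mult)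
      next
        case False
        then have "f x = 0" "f (x + t n *\<^sub>R v) = 0"
          using B_in B_in' by blast+
        then show ?thesis using False by simp
      qed
    qed
  qed (use B_int in measurable)
  have lim2: "(\<lambda>n. \<integral>x. f x * ((g (x + (- t n) *\<^sub>R v) - g x) / (- t n)) \<partial>lborel)
      \<longlonglongrightarrow> (\<integral>x. f x * g' x \<partial>lborel)"
  proof (rule integral_dominated_convergence[where w = "\<lambda>x. (F * L) * indicator B x"])
    show "AE x in lborel. (\<lambda>n. f x * ((g (x + (- t n) *\<^sub>R v) - g x) / (- t n))) \<longlonglongrightarrow> f x * g' x"
      using g'
    proof eventually_elim
      case (elim x)
      have "((\<lambda>h. (g (x + h *\<^sub>R v) - g x) / h) \<longlongrightarrow> g' x) (at 0)"
        using elim by (simp add: has_field_derivative_iff)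
      from filterlim_compose[OF this mt_at] show ?case
        by (intro tendsto_mult tendsto_const) (simp add: o_def)
    qed
    show "AE x in lborel. norm (f x * ((g (x + (- t n) *\<^sub>R v) - g x) / (- t n))) \<le> F * L * indicator B x" for n
    proof (rule AE_I2)
      fix x
      show "norm (f x * ((g (x + (- t n) *\<^sub>R v) - g x) / (- t n))) \<le> F * L * indicator B x"
      proof (cases "x \<in> B")
        case True
        have "\<bar>g (x + (- t n) *\<^sub>R v) - g x\<bar> / t n \<le> L"
          using g_lip[of x "- t n"] t_pos[of n] by (simp add: divide_le_eq)
        then have "\<bar>f x\<bar> * (\<bar>g (x + (- t n) *\<^sub>R v) - g x\<bar> / t n) \<le> F * L"
          using f_bd[of x] F0 t_pos[of n] by (intro mult_mono) auto
        then show ?thesis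
          using True t_pos[of n] by (simp add: abs_mult)
      next
        case False
        then show ?thesis using B_in[of x] by auto
      qed
    qed
  qed (use B_int in measurable)
  have shift: "(\<integral>x. (f (x + t n *\<^sub>R v) - f x) / t n * g x \<partial>lborel)
      = - (\<integral>x. f x * ((g (x + (- t n) *\<^sub>R v) - g x) / (- t n)) \<partial>lborel)" for n
  proof -
    have i1: "integrable lborel (\<lambda>x. f x * g (x + (- t n) *\<^sub>R v))" and i2: "integrable lborel (\<lambda>x. f x * g x)"
      using f_bd g_bd by (auto intro!: integrable_mult_bounded_support supp)
    have tr: "lborel = distr lborel borel (\<lambda>x. (t n *\<^sub>R v) + x :: 'a)"
      by (metis lborel_distr_plus)
    have i1': "integrable lborel (\<lambda>x. f (x + t n *\<^sub>R v) * g x)"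
      using i1 by (subst (asm) tr, subst (asm) integrable_distr_eq) (auto simp: algebra_simps)
    have e: "(\<integral>x. f x * g (x + (- t n) *\<^sub>R v) \<partial>lborel) = (\<integral>x. f (x + t n *\<^sub>R v) * g x \<partial>lborel)"
      by (subst tr, subst integral_distr) (auto simp: algebra_simps)
    have "(\<integral>x. (f (x + t n *\<^sub>R v) - f x) / t n * g x \<partial>lborel)
       = (\<integral>x. (f (x + t n *\<^sub>R v) * g x - f x * g x) / t n \<partial>lborel)"
      by (simp add: algebra_simps)
    also have "\<dots> = ((\<integral>x. f (x + t n *\<^sub>R v) * g x \<partial>lborel) - (\<integral>x. f x * g x \<partial>lborel)) / t n"
      using i1' i2 by simp
    also have "\<dots> = (\<integral>x. (f x * g (x + (- t n) *\<^sub>R v) - f x * g x) / t n \<partial>lborel)"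
      unfolding e[symmetric] using i1 i2 by simp
    also have "\<dots> = (\<integral>x. - (f x * ((g (x + (- t n) *\<^sub>R v) - g x) / (- t n))) \<partial>lborel)"
      using t_pos[of n] by (intro Bochner_Integration.integral_cong) (auto simp: field_simps)
    finally show ?thesis by simp
  qed
  show ?thesis
    using LIMSEQ_unique[OF lim1, of "- (\<integral>x. f x * g' x \<partial>lborel)"] tendsto_minus[OF lim2]
    by (simp only: shift)
qed

section \<open>Smooth functions and the rotation\<close>

lemma smooth_differentiable: "smooth f \<Longrightarrow> f differentiable (at x)"
  unfolding smooth_def by (metis foldr.simps(1) id_apply)

text \<open>Folding over a multi-index applies its last entry first, so a further derivative of
  \<^term>\<open>f\<close> is an entry appended at the end.\<close>

lemma smooth_partial_deriv: "smooth f \<Longrightarrow> smooth (partial_deriv i f)"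
  unfolding smooth_def
proof (intro allI)
  fix "is" x
  assume *: "\<forall>is x. foldr partial_deriv is f differentiable at x"
  show "foldr partial_deriv is (partial_deriv i f) differentiable at x"
    using *[rule_format, of "is @ [i]" x] by simp
qed

lemma smooth_has_derivative:
  assumes "smooth f"
  shows "(f has_derivative frechet_derivative f (at x)) (at x)"
  using smooth_differentiable[OF assms] by (simp add: frechet_derivative_works)

lemma smooth_continuous_on: "smooth f \<Longrightarrow> continuous_on S f"
  by (meson continuous_at_imp_continuous_on differentiable_imp_continuous_within smooth_differentiable)

lemma partial_deriv_eqI:
  "(f has_derivative D) (at x) \<Longrightarrow> partial_deriv i f x = D (axis i 1)"
  unfolding partial_deriv_def by (metis frechet_derivative_at)

text \<open>Only the iterated derivatives of smaller order have to be differentiable here. This is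
  what lets the induction on the order in \<open>smooth_vecI\<close> below go through.\<close>

lemma foldr_partial_deriv_nth:
  fixes f :: "real^3 \<Rightarrow> real^'n"
  assumes "\<And>js x. length js < length is \<Longrightarrow> foldr partial_deriv js f differentiable (at x)"
  shows "foldr partial_deriv is (\<lambda>x. f x $ m) = (\<lambda>x. foldr partial_deriv is f x $ m)"
  using assms
proof (induction "is")
  case (Cons i "is")
  have *: "foldr partial_deriv is (\<lambda>x. f x $ m) = (\<lambda>x. foldr partial_deriv is f x $ m)"
    by (rule Cons.IH) (use Cons.prems in auto)
  show ?case
  proof
    fix x
    let ?F = "foldr partial_deriv is f"
    have "(?F has_derivative frechet_derivative ?F (at x)) (at x)"
      using Cons.prems[of "is" x] by (simp add: frechet_derivative_works)
    then have "((\<lambda>x. ?F x $ m) has_derivative (\<lambda>h. frechet_derivative ?F (at x) h $ m)) (at x)"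
      by (rule bounded_linear.has_derivative[OF bounded_linear_vec_nth])
    then show "foldr partial_deriv (i # is) (\<lambda>x. f x $ m) x = foldr partial_deriv (i # is) f x $ m"
      by (simp add: * partial_deriv_eqI) (simp add: partial_deriv_def)
  qed
qed simp

lemma smooth_nth:
  fixes f :: "real^3 \<Rightarrow> real^'n"
  assumes "smooth f"
  shows "smooth (\<lambda>x. f x $ m)"
  unfolding smooth_def
proof (intro allI)
  fix "is" x
  have "foldr partial_deriv is f differentiable at x"
    using assms by (simp add: smooth_def)
  then have "(\<lambda>x. foldr partial_deriv is f x $ m) differentiable at x"
    unfolding differentiable_def
    by (blast intro: bounded_linear.has_derivative[OF bounded_linear_vec_nth])
  then show "foldr partial_deriv is (\<lambda>x. f x $ m) differentiable at x"
    using assms by (subst foldr_partial_deriv_nth) (auto simp: smooth_def)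
qed

lemma smooth_vecI:
  fixes f :: "real^3 \<Rightarrow> real^'n"
  assumes "\<And>m. smooth (\<lambda>x. f x $ m)"
  shows "smooth f"
proof -
  have "\<forall>x. foldr partial_deriv is f differentiable (at x)" for "is"
  proof (induction "is" rule: length_induct)
    case (1 "is")
    have "(\<lambda>x. foldr partial_deriv is f x $ m) differentiable (at x)" for m x
      using assms[of m] foldr_partial_deriv_nth[of "is" f m] 1 by (simp add: smooth_def) metis
    then show ?case
      by (auto simp: differentiable_componentwise_within[of "foldr partial_deriv is f"] Basis_vec_def
          inner_axis)
  qed
  then show ?thesis by (simp add: smooth_def)
qed

lemma smooth_diff:
  fixes f g :: "real^3 \<Rightarrow> 'b::real_normed_vector"
  assumes "smooth f" "smooth g"
  shows "smooth (\<lambda>x. f x - g x)"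
proof -
  have *: "foldr partial_deriv is (\<lambda>x. f x - g x)
      = (\<lambda>x. foldr partial_deriv is f x - foldr partial_deriv is g x)" for "is"
  proof (induction "is")
    case (Cons i "is")
    let ?f = "foldr partial_deriv is f" and ?g = "foldr partial_deriv is g"
    have "?f differentiable (at x)" "?g differentiable (at x)" for x
      using assms by (auto simp: smooth_def)
    then have "((\<lambda>x. ?f x - ?g x) has_derivative
        (\<lambda>h. frechet_derivative ?f (at x) h - frechet_derivative ?g (at x) h)) (at x)" for x
      by (auto intro!: derivative_intros simp: frechet_derivative_works)
    from partial_deriv_eqI[OF this]
    have "partial_deriv i (\<lambda>x. ?f x - ?g x) x = partial_deriv i ?f x - partial_deriv i ?g x" for x
      by (simp add: partial_deriv_def)
    then show ?case
      by (simp add: Cons fun_eq_iff)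
  qed simp
  show ?thesis
    using assms by (auto simp: smooth_def *)
qed

lemma smooth_rot:
  assumes "smooth \<theta>"
  shows "smooth (rot \<theta>)"
proof (rule smooth_vecI)
  fix m :: 3
  show "smooth (\<lambda>x. rot \<theta> x $ m)"
  proof -
    have "smooth (\<lambda>x. partial_deriv a (\<lambda>y. \<theta> y $ b) x - partial_deriv c (\<lambda>y. \<theta> y $ d) x)" for a b c d
      by (intro smooth_diff smooth_partial_deriv smooth_nth[OF assms])
    then show ?thesis
      using exhaust_3[of m] by (auto simp: rot_def)
  qed
qed

text \<open>The sign \<open>s\<close> is that of the permutation \<open>(i, j, k)\<close>; it depends neither on the field nor on
  the point.\<close>

lemma rot_nth:
  fixes i j k :: 3
  assumes "distinct [i, j, k]"
  obtains s :: real where "\<bar>s\<bar> = 1"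
    "\<And>\<theta> x. rot \<theta> x $ k = s * (partial_deriv i (\<lambda>y. \<theta> y $ j) x - partial_deriv j (\<lambda>y. \<theta> y $ i) x)"
proof -
  have "(\<forall>\<theta> x. rot \<theta> x $ k = 1 * (partial_deriv i (\<lambda>y. \<theta> y $ j) x - partial_deriv j (\<lambda>y. \<theta> y $ i) x)) \<or>
    (\<forall>\<theta> x. rot \<theta> x $ k = (-1) * (partial_deriv i (\<lambda>y. \<theta> y $ j) x - partial_deriv j (\<lambda>y. \<theta> y $ i) x))"
    using assms exhaust_3[of i] exhaust_3[of j] exhaust_3[of k] by (auto simp: rot_def)
  then show thesis
    using that[of 1] that[of "-1"] by auto
qed

lemma partial_deriv_eq_0:
  assumes "x \<notin> closure {x. f x \<noteq> 0}"
  shows "partial_deriv i f x = 0"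
proof -
  have "((\<lambda>_. 0) has_derivative (\<lambda>_. 0)) (at x)"
    by simp
  then have "(f has_derivative (\<lambda>_. 0)) (at x)"
    by (rule has_derivative_transform_within_open[of _ _ _ _ "- closure {x. f x \<noteq> 0}"])
      (use assms closure_subset[of "{x. f x \<noteq> 0}"] in auto)
  then show ?thesis by (simp add: partial_deriv_eqI)
qed

lemma bounded_support_partial_deriv:
  assumes "bounded {x. f x \<noteq> 0}"
  shows "bounded {x. partial_deriv i f x \<noteq> 0}"
  using partial_deriv_eq_0 by (intro bounded_subset[OF bounded_closure[OF assms]]) auto

lemma smooth_bounded:
  assumes "smooth f" "bounded {x. f x \<noteq> 0}"
  obtains B where "\<And>x. norm (f x) \<le> B"
proof -
  have "compact (f ` closure {x. f x \<noteq> 0})"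
    using assms by (intro compact_continuous_image smooth_continuous_on) auto
  then obtain B where B: "\<And>x. x \<in> closure {x. f x \<noteq> 0} \<Longrightarrow> norm (f x) \<le> B"
    using compact_imp_bounded[of "f ` closure {x. f x \<noteq> 0}"] by (auto simp: bounded_iff)
  have "norm (f x) \<le> max B 0" for x
    using B[of x] closure_subset[of "{x. f x \<noteq> 0}"] by (cases "f x = 0") (auto simp: le_max_iff_disj)
  then show thesis using that by blast
qed

lemma smooth_DERIV:
  fixes f :: "real^3 \<Rightarrow> real"
  assumes "smooth f"
  shows "((\<lambda>t. f (x + t *\<^sub>R axis i 1)) has_real_derivative partial_deriv i f (x + t *\<^sub>R axis i 1)) (at t)"
proof -
  let ?D = "frechet_derivative f (at (x + t *\<^sub>R axis i 1))"
  have lin: "linear ?D"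
    using smooth_differentiable[OF assms] by (rule linear_frechet_derivative)
  have "((\<lambda>t. x + t *\<^sub>R axis i 1) has_derivative (\<lambda>h. h *\<^sub>R axis i (1::real))) (at t)"
    by (auto intro!: derivative_eq_intros)
  from has_derivative_compose[OF this smooth_has_derivative[OF assms]]
  show ?thesis
    by (rule has_derivative_imp_has_field_derivative)
      (simp add: linear_scale[OF lin] partial_deriv_def)
qed

lemma smooth_lipschitz:
  fixes f :: "real^3 \<Rightarrow> real"
  assumes "smooth f" "bounded {x. f x \<noteq> 0}"
  obtains L where "\<And>x t. \<bar>f (x + t *\<^sub>R axis i 1) - f x\<bar> \<le> L * \<bar>t\<bar>"
proof -
  obtain L where L: "\<And>x. norm (partial_deriv i f x) \<le> L"
    using smooth_bounded[OF smooth_partial_deriv[OF assms(1)] bounded_support_partial_deriv[OF assms(2)]]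
    by blast
  have "\<bar>f (x + t *\<^sub>R axis i 1) - f x\<bar> \<le> L * \<bar>t\<bar>" for x t
    using field_differentiable_bound[of UNIV "\<lambda>t. f (x + t *\<^sub>R axis i 1)" 
        "\<lambda>t. partial_deriv i f (x + t *\<^sub>R axis i 1)" L t 0] smooth_DERIV[OF assms(1)] L
    by simp
  then show thesis using that by blast
qed

section \<open>Square-integrable fields\<close>

lemma L2_inner_integrable:
  fixes f g :: "real^3 \<Rightarrow> 'b::euclidean_space"
  assumes f: "f \<in> L2 \<omega>" and g: "g \<in> L2 \<omega>"
  shows "integrable (lebesgue_on \<omega>) (\<lambda>x. f x \<bullet> g x)"
proof (rule Bochner_Integration.integrable_bound)
  show "integrable (lebesgue_on \<omega>) (\<lambda>x. (norm (f x))\<^sup>2 + (norm (g x))\<^sup>2)"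
    using f g by (auto simp: L2_def)
  show "(\<lambda>x. f x \<bullet> g x) \<in> borel_measurable (lebesgue_on \<omega>)"
    using f g by (auto simp: L2_def)
  have "\<bar>a \<bullet> b\<bar> \<le> (norm a)\<^sup>2 + (norm b)\<^sup>2" for a b :: 'b
    using Cauchy_Schwarz_ineq2[of a b] sum_squares_bound[of "norm a" "norm b"]
      mult_nonneg_nonneg[of "norm a" "norm b"] by simp
  then show "AE x in lebesgue_on \<omega>. norm (f x \<bullet> g x) \<le> norm ((norm (f x))\<^sup>2 + (norm (g x))\<^sup>2)"
    by (intro AE_I2) simp
qed

lemma L2_Cauchy_Schwarz:
  fixes f g :: "real^3 \<Rightarrow> 'b::euclidean_space"
  assumes f: "f \<in> L2 \<omega>" and g: "g \<in> L2 \<omega>"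
  shows "\<bar>\<integral>x. f x \<bullet> g x \<partial>lebesgue_on \<omega>\<bar> \<le> L2_norm \<omega> f * L2_norm \<omega> g"
proof -
  define A where "A = (\<integral>x. (norm (f x))\<^sup>2 \<partial>lebesgue_on \<omega>)"
  define C where "C = (\<integral>x. (norm (g x))\<^sup>2 \<partial>lebesgue_on \<omega>)"
  define P where "P = (\<integral>x. f x \<bullet> g x \<partial>lebesgue_on \<omega>)"
  have C0: "C \<ge> 0"
    by (simp add: C_def)
  \<comment> \<open>The discriminant argument: the quadratic polynomial \<open>\<integral> |f - s g|\<^sup>2\<close> in \<open>s\<close> is nonnegative.\<close>
  have quad: "0 \<le> A - 2 * s * P + s\<^sup>2 * C" for s
  proof -
    have "0 \<le> (\<integral>x. (norm (f x - s *\<^sub>R g x))\<^sup>2 \<partial>lebesgue_on \<omega>)"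
      by simp
    also have "\<dots> = (\<integral>x. (norm (f x))\<^sup>2 - 2 * s * (f x \<bullet> g x) + s\<^sup>2 * (norm (g x))\<^sup>2 \<partial>lebesgue_on \<omega>)"
      by (intro Bochner_Integration.integral_cong)
        (auto simp: power2_norm_eq_inner inner_diff_left inner_diff_right inner_commute algebra_simps,
          simp add: power2_eq_square)
    also have "\<dots> = A - 2 * s * P + s\<^sup>2 * C"
      using f g L2_inner_integrable[OF f g] by (simp add: A_def C_def P_def L2_def)
    finally show ?thesis .
  qed
  have "P\<^sup>2 \<le> A * C"
  proof (cases "C = 0")
    case True
    \<comment> \<open>Here the polynomial is affine, and at this \<open>s\<close> it would take the value \<open>-1\<close> if \<open>P \<noteq> 0\<close>.\<close>
    have "P = 0"
      using quad[of "(A + 1) / (2 * P)"] True by (cases "P = 0") (auto simp: field_simps)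
    then show ?thesis using True by simp
  next
    case False
    then have "C > 0" using C0 by simp
    then show ?thesis
      using quad[of "P / C"] by (simp add: field_simps power2_eq_square)
  qed
  then have "\<bar>P\<bar> \<le> sqrt (A * C)"
    by (rule real_le_rsqrt[of "\<bar>P\<bar>", simplified])
  then show ?thesis
    by (simp add: L2_norm_def A_def C_def P_def real_sqrt_mult)
qed

lemma L2_diff:
  fixes f g :: "real^3 \<Rightarrow> 'b::euclidean_space"
  assumes f: "f \<in> L2 \<omega>" and g: "g \<in> L2 \<omega>"
  shows "(\<lambda>x. f x - g x) \<in> L2 \<omega>"
proof -
  have "integrable (lebesgue_on \<omega>) (\<lambda>x. (norm (f x))\<^sup>2 - 2 * (f x \<bullet> g x) + (norm (g x))\<^sup>2)"
    using f g L2_inner_integrable[OF f g] by (simp add: L2_def)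
  moreover have "(norm (f x))\<^sup>2 - 2 * (f x \<bullet> g x) + (norm (g x))\<^sup>2 = (norm (f x - g x))\<^sup>2" for x
    by (simp add: power2_norm_eq_inner inner_diff_left inner_diff_right inner_commute)
  moreover have "(\<lambda>x. f x - g x) \<in> borel_measurable (lebesgue_on \<omega>)"
    using f g by (intro borel_measurable_diff) (auto simp: L2_def)
  ultimately show ?thesis
    by (simp add: L2_def)
qed

lemma bounded_in_L2:
  fixes f :: "real^3 \<Rightarrow> 'b::euclidean_space"
  assumes "\<omega> \<in> lmeasurable" and [measurable]: "f \<in> borel_measurable borel" and B: "\<And>x. norm (f x) \<le> B"
  shows "f \<in> L2 \<omega>"
proof -
  have m: "f \<in> borel_measurable (lebesgue_on \<omega>)"
    by (intro measurable_restrict_space1 measurable_completion) simp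
  interpret finite_measure "lebesgue_on \<omega>"
    using assms(1) by (rule finite_measure_lebesgue_on)
  have "integrable (lebesgue_on \<omega>) (\<lambda>x. (norm (f x))\<^sup>2)"
    using m B by (intro integrable_const_bound[of _ "B\<^sup>2"]) (auto intro!: power_mono)
  with m show ?thesis by (simp add: L2_def)
qed

lemma integral_lebesgue_on_eq_lborel:
  fixes f :: "'a::euclidean_space \<Rightarrow> real"
  assumes "\<omega> \<in> sets borel" "f \<in> borel_measurable borel" "\<And>x. x \<notin> \<omega> \<Longrightarrow> f x = 0"
  shows "(\<integral>x. f x \<partial>lebesgue_on \<omega>) = (\<integral>x. f x \<partial>lborel)"
proof -
  have "(\<integral>x. f x \<partial>lebesgue_on \<omega>) = (\<integral>x. indicator \<omega> x *\<^sub>R f x \<partial>lebesgue)"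
    using assms(1) by (subst integral_restrict_space) (auto simp: set_lebesgue_integral_def)
  also have "(\<lambda>x. indicator \<omega> x *\<^sub>R f x) = f"
    using assms(3) by (auto simp: indicator_def fun_eq_iff)
  finally show ?thesis
    using assms(2) by (simp add: integral_completion)
qed

lemma L2_component_subset:
  fixes \<phi> :: "real^3 \<Rightarrow> real^'n"
  assumes \<phi>: "\<phi> \<in> L2 \<Omega>" and "\<Omega> \<in> sets lebesgue" "\<omega> \<in> sets lebesgue" "\<omega> \<subseteq> \<Omega>"
  shows "(\<lambda>x. \<phi> x $ i) \<in> L2 \<omega>"
proof -
  have m: "\<phi> \<in> borel_measurable (lebesgue_on \<Omega>)" and int: "integrable (lebesgue_on \<Omega>) (\<lambda>x. (norm (\<phi> x))\<^sup>2)"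
    using \<phi> by (auto simp: L2_def)
  have m\<omega>: "\<phi> \<in> borel_measurable (lebesgue_on \<omega>)"
    using m assms(4) by (rule measurable_restrict_mono)
  have "(\<lambda>v :: real^'n. v $ i) \<in> borel_measurable borel"
    by (intro borel_measurable_continuous_onI continuous_intros)
  then have mi: "(\<lambda>x. \<phi> x $ i) \<in> borel_measurable (lebesgue_on \<omega>)"
    using m\<omega> by (rule measurable_compose_rev)
  have "integrable (lebesgue_on \<omega>) (\<lambda>x. (norm (\<phi> x))\<^sup>2)"
    using int set_integrable_subset[of lebesgue \<Omega> "\<lambda>x. (norm (\<phi> x))\<^sup>2" \<omega>] assms(2-4)
    by (simp add: integrable_restrict_space set_integrable_def)
  then have "integrable (lebesgue_on \<omega>) (\<lambda>x. (norm (\<phi> x $ i))\<^sup>2)"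
  proof (rule Bochner_Integration.integrable_bound)
    show "(\<lambda>x. (norm (\<phi> x $ i))\<^sup>2) \<in> borel_measurable (lebesgue_on \<omega>)"
      using mi by measurable
    show "AE x in lebesgue_on \<omega>. norm ((norm (\<phi> x $ i))\<^sup>2) \<le> norm ((norm (\<phi> x))\<^sup>2)"
      by (intro AE_I2) (simp add: norm_bound_component_le_cart abs_le_square_iff[symmetric] component_le_norm_cart)
  qed
  then show ?thesis
    using mi by (auto simp: L2_def)
qed

section \<open>Test fields and their rotation\<close>

lemma smooth_borel_measurable:
  fixes f :: "real^3 \<Rightarrow> 'b::real_normed_vector"
  shows "smooth f \<Longrightarrow> f \<in> borel_measurable borel"
  by (rule borel_measurable_continuous_onI[OF smooth_continuous_on])

lemma integration_by_parts_smooth: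
  fixes f g g' :: "real^3 \<Rightarrow> real"
  assumes f: "smooth f" "bounded {x. f x \<noteq> 0}"
    and [measurable]: "g \<in> borel_measurable borel" "g' \<in> borel_measurable borel"
    and "\<And>x. \<bar>g x\<bar> \<le> G"
    and "\<And>x t. \<bar>g (x + t *\<^sub>R axis i 1) - g x\<bar> \<le> L * \<bar>t\<bar>"
    and "AE x in lborel. ((\<lambda>t. g (x + t *\<^sub>R axis i 1)) has_real_derivative g' x) (at 0)"
  shows "(\<integral>x. partial_deriv i f x * g x \<partial>lborel) = - (\<integral>x. f x * g' x \<partial>lborel)"
proof -
  obtain F where F: "\<And>x. norm (f x) \<le> F"
    using smooth_bounded[OF f] by blast
  obtain K where K: "\<And>x t. \<bar>f (x + t *\<^sub>R axis i 1) - f x\<bar> \<le> K * \<bar>t\<bar>"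
    using smooth_lipschitz[OF f] by blast
  have "((\<lambda>t. f (x + t *\<^sub>R axis i 1)) has_real_derivative partial_deriv i f x) (at 0)" for x
    using smooth_DERIV[OF f(1), of x i 0] by simp
  then show ?thesis
    using assms F K
    by (intro integration_by_parts_directional[where v = "axis i 1" and F = F and K = K and G = G and L = L])
      (auto intro!: smooth_borel_measurable smooth_partial_deriv)
qed

lemma integration_by_parts_smooth_smooth:
  fixes f g :: "real^3 \<Rightarrow> real"
  assumes f: "smooth f" "bounded {x. f x \<noteq> 0}" and g: "smooth g" "bounded {x. g x \<noteq> 0}"
  shows "(\<integral>x. partial_deriv i f x * g x \<partial>lborel) = - (\<integral>x. f x * partial_deriv i g x \<partial>lborel)"
proof -
  obtain G where G: "\<And>x. norm (g x) \<le> G"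
    using smooth_bounded[OF g] by blast
  obtain L where L: "\<And>x t. \<bar>g (x + t *\<^sub>R axis i 1) - g x\<bar> \<le> L * \<bar>t\<bar>"
    using smooth_lipschitz[OF g] by blast
  show ?thesis
  proof (rule integration_by_parts_smooth[OF f, where G = G and L = L])
    show "AE x in lborel. ((\<lambda>t. g (x + t *\<^sub>R axis i 1)) has_real_derivative partial_deriv i g x) (at 0)"
      using smooth_DERIV[OF g(1), of _ i 0] by (intro AE_I2) simp
  qed (use G L g in \<open>auto intro!: smooth_borel_measurable smooth_partial_deriv\<close>)
qed

lemma integrable_smooth_mult:
  fixes f g :: "real^3 \<Rightarrow> real"
  assumes f: "smooth f" "bounded {x. f x \<noteq> 0}" and "g \<in> borel_measurable borel" "\<And>x. \<bar>g x\<bar> \<le> G"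
  shows "integrable lborel (\<lambda>x. f x * g x)"
proof -
  obtain F where "\<And>x. norm (f x) \<le> F"
    using smooth_bounded[OF f] by blast
  then show ?thesis
    using assms smooth_borel_measurable[OF f(1)]
    by (intro integrable_mult_bounded_support[where F = F and G = G]) auto
qed

lemma test_fieldsD:
  assumes "\<theta> \<in> test_fields \<Omega>"
  shows "smooth \<theta>" "bounded {x. \<theta> x \<noteq> 0}" "closure {x. \<theta> x \<noteq> 0} \<subseteq> \<Omega>" "x \<notin> \<Omega> \<Longrightarrow> \<theta> x = 0"
    "smooth (\<lambda>x. \<theta> x $ m)" "bounded {x. \<theta> x $ m \<noteq> 0}"
proof -
  show s: "smooth \<theta>" and b: "bounded {x. \<theta> x \<noteq> 0}" and c: "closure {x. \<theta> x \<noteq> 0} \<subseteq> \<Omega>"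
    using assms by (auto simp: test_fields_def intro: bounded_subset[OF compact_imp_bounded closure_subset])
  show "x \<notin> \<Omega> \<Longrightarrow> \<theta> x = 0"
    using c closure_subset[of "{x. \<theta> x \<noteq> 0}"] by auto
  show "smooth (\<lambda>x. \<theta> x $ m)" using s by (rule smooth_nth)
  show "bounded {x. \<theta> x $ m \<noteq> 0}" by (rule bounded_subset[OF b]) auto
qed

lemma rot_test_fields:
  assumes "\<theta> \<in> test_fields \<Omega>"
  shows "rot \<theta> \<in> test_fields \<Omega>"
proof -
  let ?S = "closure {x. \<theta> x \<noteq> 0}"
  have "rot \<theta> x = 0" if "x \<notin> ?S" for x
  proof -
    have "x \<notin> closure {x. \<theta> x $ m \<noteq> 0}" for m
      using that closure_mono[of "{x. \<theta> x $ m \<noteq> 0}" "{x. \<theta> x \<noteq> 0}"]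
      by (metis (mono_tags, lifting) Collect_mono subsetD zero_index)
    then have "partial_deriv a (\<lambda>y. \<theta> y $ m) x = 0" for a m
      by (intro partial_deriv_eq_0)
    then show ?thesis
      by (simp add: rot_def vec_eq_iff forall_3)
  qed
  then have "closure {x. rot \<theta> x \<noteq> 0} \<subseteq> ?S"
    by (intro closure_minimal) auto
  moreover have "compact ?S" "?S \<subseteq> \<Omega>" "smooth \<theta>"
    using assms by (auto simp: test_fields_def)
  ultimately show ?thesis
    unfolding test_fields_def using smooth_rot bounded_subset[OF compact_imp_bounded[OF \<open>compact ?S\<close>]]
    by (simp add: compact_eq_bounded_closed)
qed

lemma test_fields_L2:
  assumes "\<Omega> \<in> lmeasurable" "\<theta> \<in> test_fields \<Omega>"
  shows "\<theta> \<in> L2 \<Omega>"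
  using smooth_bounded[OF test_fieldsD(1,2)[OF assms(2)]] bounded_in_L2[OF assms(1)]
    smooth_borel_measurable[OF test_fieldsD(1)[OF assms(2)]] by metis

text \<open>The weak rotation extends the classical one on test fields.\<close>

lemma has_weak_rot_rot:
  assumes "open \<Omega>" and \<theta>: "\<theta> \<in> test_fields \<Omega>"
  shows "has_weak_rot \<Omega> \<theta> (rot \<theta>)"
  unfolding has_weak_rot_def
proof
  fix \<eta> assume \<eta>: "\<eta> \<in> test_fields \<Omega>"
  note smooth_borel_measurable[OF test_fieldsD(1), OF \<theta>, measurable]
    smooth_borel_measurable[OF test_fieldsD(1), OF \<eta>, measurable]
    smooth_borel_measurable[OF test_fieldsD(1)[OF rot_test_fields], OF \<theta>, measurable]
    smooth_borel_measurable[OF test_fieldsD(1)[OF rot_test_fields], OF \<eta>, measurable]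
  \<comment> \<open>Both sides expand into six integrals of this form, which integration by parts matches.\<close>
  define P where "P a b c = (\<integral>x. \<theta> x $ a * partial_deriv b (\<lambda>y. \<eta> y $ c) x \<partial>lborel)" for a b c
  have Q: "(\<integral>x. partial_deriv b (\<lambda>y. \<theta> y $ a) x * \<eta> x $ c \<partial>lborel) = - P a b c" for a b c
    unfolding P_def by (intro integration_by_parts_smooth_smooth test_fieldsD[OF \<theta>] test_fieldsD[OF \<eta>])
  have int1: "integrable lborel (\<lambda>x. \<theta> x $ a * partial_deriv b (\<lambda>y. \<eta> y $ c) x)"
    and int2: "integrable lborel (\<lambda>x. partial_deriv b (\<lambda>y. \<theta> y $ a) x * \<eta> x $ c)" for a b c
  proof -
    note s\<theta> = test_fieldsD(5,6)[OF \<theta>, of a] and s\<eta> = test_fieldsD(5,6)[OF \<eta>, of c]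
    have s: "smooth (partial_deriv b (\<lambda>y. \<eta> y $ c))" "bounded {x. partial_deriv b (\<lambda>y. \<eta> y $ c) x \<noteq> 0}"
      using s\<eta> by (auto intro: smooth_partial_deriv bounded_support_partial_deriv)
    obtain G where "\<And>x. norm (partial_deriv b (\<lambda>y. \<eta> y $ c) x) \<le> G"
      using smooth_bounded[OF s] by blast
    then show "integrable lborel (\<lambda>x. \<theta> x $ a * partial_deriv b (\<lambda>y. \<eta> y $ c) x)"
      using s s\<theta> by (intro integrable_smooth_mult[where G = G] smooth_borel_measurable) auto
    obtain H where "\<And>x. norm (\<eta> x $ c) \<le> H"
      using smooth_bounded[OF s\<eta>] by blast
    then show "integrable lborel (\<lambda>x. partial_deriv b (\<lambda>y. \<theta> y $ a) x * \<eta> x $ c)"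
      using s\<theta> s\<eta> by (intro integrable_smooth_mult[where G = H] smooth_borel_measurable
          smooth_partial_deriv bounded_support_partial_deriv) auto
  qed
  have "(\<integral>x. \<theta> x \<bullet> rot \<eta> x \<partial>lebesgue_on \<Omega>) = (\<integral>x. \<theta> x \<bullet> rot \<eta> x \<partial>lborel)"
    using \<open>open \<Omega>\<close> test_fieldsD(4)[OF \<theta>] by (intro integral_lebesgue_on_eq_lborel) auto
  also have "\<dots> = P 1 2 3 - P 1 3 2 + (P 2 3 1 - P 2 1 3) + (P 3 1 2 - P 3 2 1)"
    by (simp add: inner_vec_def sum_3 rot_def right_diff_distrib int1 P_def)
  also have "\<dots> = (\<integral>x. rot \<theta> x \<bullet> \<eta> x \<partial>lborel)"
    by (simp add: inner_vec_def sum_3 rot_def left_diff_distrib int2 Q)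
  also have "\<dots> = (\<integral>x. rot \<theta> x \<bullet> \<eta> x \<partial>lebesgue_on \<Omega>)"
    using \<open>open \<Omega>\<close> test_fieldsD(4)[OF \<eta>] by (intro integral_lebesgue_on_eq_lborel[symmetric]) auto
  finally show "(\<integral>x. \<theta> x \<bullet> rot \<eta> x \<partial>lebesgue_on \<Omega>) = (\<integral>x. rot \<theta> x \<bullet> \<eta> x \<partial>lebesgue_on \<Omega>)" .
qed

text \<open>If the rotation of \<open>\<phi>\<close> vanishes, then the rotation of a test field \<open>\<theta>\<close> is controlled by the
  graph norm of \<open>\<phi> - \<theta>\<close>.\<close>

lemma L2_norm_rot_le:
  assumes "open \<Omega>" "bounded \<Omega>" "\<phi> \<in> R_ring_0 \<Omega>" and \<theta>: "\<theta> \<in> test_fields \<Omega>"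
  shows "L2_norm \<Omega> (rot \<theta>) \<le> L2_norm \<Omega> (weak_rot \<Omega> (\<lambda>x. \<phi> x - \<theta> x))"
proof -
  have lm: "\<Omega> \<in> lmeasurable"
    using assms by (simp add: lmeasurable_open)
  have \<phi>: "\<phi> \<in> L2 \<Omega>" "\<exists>\<psi>. \<psi> \<in> L2 \<Omega> \<and> has_weak_rot \<Omega> \<phi> \<psi>" "AE x in lebesgue_on \<Omega>. weak_rot \<Omega> \<phi> x = 0"
    using assms(3) by (auto simp: R_ring_0_def R_ring_def R_space_def)
  have wr: "has_weak_rot \<Omega> \<phi> (weak_rot \<Omega> \<phi>)"
    using someI_ex[OF \<phi>(2)] by (simp add: weak_rot_def)
  have \<phi>_rot: "(\<integral>x. \<phi> x \<bullet> rot \<eta> x \<partial>lebesgue_on \<Omega>) = 0" if "\<eta> \<in> test_fields \<Omega>" for \<eta>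
  proof -
    have "(\<integral>x. weak_rot \<Omega> \<phi> x \<bullet> \<eta> x \<partial>lebesgue_on \<Omega>) = 0"
      using \<phi>(3) by (intro integral_eq_zero_AE) auto
    then show ?thesis
      using wr that by (simp add: has_weak_rot_def)
  qed
  have diff_rot: "(\<integral>x. (\<phi> x - \<theta> x) \<bullet> rot \<eta> x \<partial>lebesgue_on \<Omega>) = - (\<integral>x. rot \<theta> x \<bullet> \<eta> x \<partial>lebesgue_on \<Omega>)"
    if \<eta>: "\<eta> \<in> test_fields \<Omega>" for \<eta>
  proof -
    have "rot \<eta> \<in> L2 \<Omega>" "\<theta> \<in> L2 \<Omega>"
      using \<eta> \<theta> by (auto intro: test_fields_L2[OF lm] rot_test_fields)
    then have "(\<integral>x. (\<phi> x - \<theta> x) \<bullet> rot \<eta> x \<partial>lebesgue_on \<Omega>)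
        = (\<integral>x. \<phi> x \<bullet> rot \<eta> x \<partial>lebesgue_on \<Omega>) - (\<integral>x. \<theta> x \<bullet> rot \<eta> x \<partial>lebesgue_on \<Omega>)"
      using \<phi>(1) by (simp add: inner_diff_left L2_inner_integrable)
    then show ?thesis
      using has_weak_rot_rot[OF \<open>open \<Omega>\<close> \<theta>] \<eta> \<phi>_rot[OF \<eta>] by (simp add: has_weak_rot_def)
  qed
  define w where "w = weak_rot \<Omega> (\<lambda>x. \<phi> x - \<theta> x)"
  have rot_L2: "rot \<theta> \<in> L2 \<Omega>"
    using \<theta> by (auto intro: test_fields_L2[OF lm] rot_test_fields)
  have "(\<lambda>x. - rot \<theta> x) \<in> L2 \<Omega>"
    using rot_L2 by (simp add: L2_def)
  moreover have "has_weak_rot \<Omega> (\<lambda>x. \<phi> x - \<theta> x) (\<lambda>x. - rot \<theta> x)"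
    by (simp add: has_weak_rot_def diff_rot)
  ultimately have w: "w \<in> L2 \<Omega>" "has_weak_rot \<Omega> (\<lambda>x. \<phi> x - \<theta> x) w"
    unfolding w_def weak_rot_def by (metis (mono_tags, lifting) someI_ex)+
  \<comment> \<open>Testing \<open>w\<close> with the test field \<open>rot \<theta>\<close> makes uniqueness of weak rotations unnecessary.\<close>
  have "(L2_norm \<Omega> (rot \<theta>))\<^sup>2 = (\<integral>x. rot \<theta> x \<bullet> rot \<theta> x \<partial>lebesgue_on \<Omega>)"
    by (simp add: L2_norm_def power2_norm_eq_inner)
  also have "\<dots> = - (\<integral>x. w x \<bullet> rot \<theta> x \<partial>lebesgue_on \<Omega>)"
    using w(2)[unfolded has_weak_rot_def, rule_format, OF rot_test_fields[OF \<theta>]]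
      diff_rot[OF rot_test_fields[OF \<theta>]] by simp
  also have "\<dots> \<le> L2_norm \<Omega> w * L2_norm \<Omega> (rot \<theta>)"
    using L2_Cauchy_Schwarz[OF w(1) rot_L2] by linarith
  finally have "L2_norm \<Omega> (rot \<theta>) * L2_norm \<Omega> (rot \<theta>) \<le> L2_norm \<Omega> w * L2_norm \<Omega> (rot \<theta>)"
    by (simp add: power2_eq_square)
  moreover have "L2_norm \<Omega> (rot \<theta>) \<ge> 0" "L2_norm \<Omega> w \<ge> 0"
    by (auto simp: L2_norm_def)
  ultimately show ?thesis
    unfolding w_def[symmetric] by (metis mult_le_cancel_right order_le_less not_less)
qed

section \<open>The rotation of a field against a ramp\<close>

text \<open>For \<open>a \<le> b\<close>, the antiderivative of the indicator of the interval from \<open>a\<close> to \<open>b\<close> that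
  vanishes on the left of \<open>a\<close>: it rises from 0 at \<open>a\<close> to \<open>b - a\<close> at \<open>b\<close>.\<close>

definition ramp :: "real \<Rightarrow> real \<Rightarrow> real \<Rightarrow> real" where
  "ramp a b t = max a (min b t) - a"

lemma ramp_lipschitz: "\<bar>ramp a b (t + s) - ramp a b t\<bar> \<le> \<bar>s\<bar>"
  by (auto simp: ramp_def max_def min_def)

lemma ramp_bounded: "a \<le> b \<Longrightarrow> \<bar>ramp a b t\<bar> \<le> b - a"
  by (auto simp: ramp_def max_def min_def)

lemma ramp_measurable [measurable]: "ramp a b \<in> borel_measurable borel"
  unfolding ramp_def by measurable

lemma ramp_DERIV:
  assumes "a < b" "t \<noteq> a" "t \<noteq> b"
  shows "(ramp a b has_real_derivative indicator {a<..<b} t) (at t)"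
proof -
  consider "t < a" | "a < t" "t < b" | "b < t" using assms by linarith
  then show ?thesis
  proof cases
    case 1
    have "((\<lambda>_. 0) has_real_derivative 0) (at t)" by simp
    then have "(ramp a b has_real_derivative 0) (at t)"
      by (rule has_field_derivative_transform_within_open[where S = "{..<a}"])
        (use 1 assms in \<open>auto simp: ramp_def\<close>)
    then show ?thesis using 1 by simp
  next
    case 2
    have "((\<lambda>t. t - a) has_real_derivative 1) (at t)"
      by (auto intro!: derivative_eq_intros)
    then have "(ramp a b has_real_derivative 1) (at t)"
      by (rule has_field_derivative_transform_within_open[where S = "{a<..<b}"])
        (use 2 assms in \<open>auto simp: ramp_def\<close>)
    then show ?thesis using 2 by simp
  next
    case 3
    have "((\<lambda>_. b - a) has_real_derivative 0) (at t)" by simp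
    then have "(ramp a b has_real_derivative 0) (at t)"
      by (rule has_field_derivative_transform_within_open[where S = "{b<..}"])
        (use 3 assms in \<open>auto simp: ramp_def\<close>)
    then show ?thesis using 3 by simp
  qed
qed

lemma AE_nth_neq: "AE x in lborel. (x :: real^'n) $ j \<noteq> a"
proof -
  have "negligible {x :: real^'n. axis j 1 \<bullet> x = a}"
    by (rule negligible_hyperplane) simp
  then have "{x :: real^'n. x $ j = a} \<in> null_sets lebesgue"
    by (simp add: inner_axis' negligible_iff_null_sets)
  then have "AE x in lebesgue. (x :: real^'n) $ j \<noteq> a"
    by (rule AE_I') auto
  then show ?thesis by (simp add: AE_completion_iff)
qed

text \<open>With \<open>h(x) = ramp a b x\<^sub>j q(x\<^sub>k)\<close>, the rotation of \<open>h e\<^sub>k\<close> is \<open>\<partial>\<^sub>j h e\<^sub>i\<close> up to sign, because \<open>h\<close> is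
  constant in \<open>x\<^sub>i\<close>. The identity is the adjointness of the rotation, tested with \<open>h e\<^sub>k\<close>. The factor
  \<open>q\<close> is never differentiated, so it may be discontinuous.\<close>

lemma integral_rot_ramp:
  fixes i j k :: 3
  assumes \<theta>: "smooth \<theta>" "bounded {x. \<theta> x \<noteq> 0}" and ijk: "distinct [i, j, k]"
    and "a < b" and [measurable]: "q \<in> borel_measurable borel" and q: "\<And>t. \<bar>q t\<bar> \<le> 1"
  shows "\<bar>\<integral>x. \<theta> x $ i * (indicator {a<..<b} (x $ j) * q (x $ k)) \<partial>lborel\<bar>
    = \<bar>\<integral>x. rot \<theta> x $ k * (ramp a b (x $ j) * q (x $ k)) \<partial>lborel\<bar>"
proof -
  let ?h = "\<lambda>x :: real^3. ramp a b (x $ j) * q (x $ k)"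
  obtain s where s: "\<bar>s\<bar> = 1" "\<And>\<theta> x. rot \<theta> x $ k
      = s * (partial_deriv i (\<lambda>y. \<theta> y $ j) x - partial_deriv j (\<lambda>y. \<theta> y $ i) x)"
    using rot_nth[OF ijk] by blast
  have sm: "smooth (\<lambda>x. \<theta> x $ m)" and bd: "bounded {x. \<theta> x $ m \<noteq> 0}" for m
    using \<theta> by (auto intro: smooth_nth bounded_subset)
  have h_bd: "\<bar>?h x\<bar> \<le> b - a" for x
    using mult_mono[OF ramp_bounded[of a b "x $ j"] q[of "x $ k"]] \<open>a < b\<close> by (simp add: abs_mult)
  have shift: "(x + t *\<^sub>R axis n 1) $ m = x $ m + (if m = n then t else 0)" for x :: "real^3" and n m t
    by (simp add: axis_def)
  have ne: "k \<noteq> j" "k \<noteq> i" "j \<noteq> i"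
    using ijk by auto
  have eq1: "(\<integral>x. partial_deriv j (\<lambda>y. \<theta> y $ i) x * ?h x \<partial>lborel)
      = - (\<integral>x. \<theta> x $ i * (indicator {a<..<b} (x $ j) * q (x $ k)) \<partial>lborel)"
  proof (rule integration_by_parts_smooth[OF sm bd, where G = "b - a" and L = 1])
    show "\<bar>?h (x + t *\<^sub>R axis j 1) - ?h x\<bar> \<le> 1 * \<bar>t\<bar>" for x t
      using mult_mono[OF ramp_lipschitz[of a b "x $ j" t] q[of "x $ k"]] ne
      by (simp only: shift) (simp add: abs_mult flip: left_diff_distrib)
    show "AE x in lborel. ((\<lambda>t. ?h (x + t *\<^sub>R axis j 1))
        has_real_derivative indicator {a<..<b} (x $ j) * q (x $ k)) (at 0)"
      using AE_nth_neq[of j a] AE_nth_neq[of j b]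
    proof eventually_elim
      case (elim x)
      have "((\<lambda>t. ramp a b (t + x $ j)) has_real_derivative indicator {a<..<b} (x $ j)) (at 0)"
        using ramp_DERIV[OF \<open>a < b\<close> elim] DERIV_shift[of "ramp a b" _ 0 "x $ j"] by simp
      from DERIV_cmult_right[OF this, of "q (x $ k)"] show ?case
        using ne by (simp only: shift) (simp add: add.commute)
    qed
  qed (use h_bd in auto)
  have eq2: "(\<integral>x. partial_deriv i (\<lambda>y. \<theta> y $ j) x * ?h x \<partial>lborel) = - (\<integral>x. \<theta> x $ j * 0 \<partial>lborel)"
  proof (rule integration_by_parts_smooth[OF sm bd, where G = "b - a" and L = 0])
    show "\<bar>?h (x + t *\<^sub>R axis i 1) - ?h x\<bar> \<le> 0 * \<bar>t\<bar>" for x t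
      using ne by (simp only: shift) simp
    show "AE x in lborel. ((\<lambda>t. ?h (x + t *\<^sub>R axis i 1)) has_real_derivative 0) (at 0)"
      using ne by (simp only: shift) simp
  qed (use h_bd in auto)
  have int: "integrable lborel (\<lambda>x. partial_deriv m (\<lambda>y. \<theta> y $ n) x * ?h x)" for m n
    using h_bd by (intro integrable_smooth_mult[where G = "b - a"] smooth_partial_deriv sm
      bounded_support_partial_deriv bd) auto
  have "(\<integral>x. rot \<theta> x $ k * ?h x \<partial>lborel)
      = (\<integral>x. s * (partial_deriv i (\<lambda>y. \<theta> y $ j) x * ?h x - partial_deriv j (\<lambda>y. \<theta> y $ i) x * ?h x) \<partial>lborel)"
    by (simp add: s(2) algebra_simps)
  also have "\<dots> = s * (\<integral>x. \<theta> x $ i * (indicator {a<..<b} (x $ j) * q (x $ k)) \<partial>lborel)"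
    using eq1 eq2 int by (simp add: Bochner_Integration.integral_diff)
  finally show ?thesis
    using s(1) by (simp add: abs_mult)
qed

section \<open>Mean values over cuboids\<close>

theorem corollary4:
  fixes \<Omega> :: "(real^3) set" and l :: "real^3" and \<phi> :: "real^3 \<Rightarrow> real^3"
    and i j k :: 3 and \<alpha>\<^sub>j \<beta>\<^sub>j \<alpha>\<^sub>k \<beta>\<^sub>k :: real
  assumes "open \<Omega>" and "connected \<Omega>" and "bounded \<Omega>"
    and "smallest_box \<Omega> l"
    and "\<phi> \<in> R_ring_0 \<Omega>"
    and "distinct [i, j, k]"
    and "0 \<le> \<alpha>\<^sub>j" and "\<alpha>\<^sub>j < \<beta>\<^sub>j" and "\<beta>\<^sub>j \<le> l $ j"
    and "0 \<le> \<alpha>\<^sub>k" and "\<alpha>\<^sub>k < \<beta>\<^sub>k" and "\<beta>\<^sub>k \<le> l $ k"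
  shows "(\<lambda>x. \<phi> x $ i) \<in>
    L2_mean_zero {x \<in> \<Omega>. \<alpha>\<^sub>j < x $ j \<and> x $ j < \<beta>\<^sub>j \<and> \<alpha>\<^sub>k < x $ k \<and> x $ k < \<beta>\<^sub>k}"
proof -
  define \<omega> where "\<omega> = {x \<in> \<Omega>. \<alpha>\<^sub>j < x $ j \<and> x $ j < \<beta>\<^sub>j \<and> \<alpha>\<^sub>k < x $ k \<and> x $ k < \<beta>\<^sub>k}"
  define q where "q = indicat_real {\<alpha>\<^sub>k<..<\<beta>\<^sub>k}"
  define X where "X x = indicator {\<alpha>\<^sub>j<..<\<beta>\<^sub>j} (x $ j) * q (x $ k)" for x :: "real^3"
  define h where "h x = ramp \<alpha>\<^sub>j \<beta>\<^sub>j (x $ j) * q (x $ k)" for x :: "real^3"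
  define E where "E x = X x *\<^sub>R (axis i 1 :: real^3)" for x
  define H where "H x = h x *\<^sub>R (axis k 1 :: real^3)" for x
  have q_meas [measurable]: "q \<in> borel_measurable borel" and q_bd: "\<bar>q t\<bar> \<le> 1" for t
    by (auto simp: q_def indicator_def)
  have [measurable]: "E \<in> borel_measurable borel" "H \<in> borel_measurable borel"
    unfolding E_def H_def X_def h_def by measurable
  have lm: "\<Omega> \<in> lmeasurable"
    using assms by (simp add: lmeasurable_open)
  have \<phi>: "\<phi> \<in> L2 \<Omega>"
    using assms by (auto simp: R_ring_0_def R_ring_def R_space_def)
  have \<omega>_sets: "\<omega> \<in> sets borel" "\<omega> \<subseteq> \<Omega>"
    using \<open>open \<Omega>\<close> unfolding \<omega>_def by auto
  have E_L2: "E \<in> L2 \<Omega>"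
    by (rule bounded_in_L2[OF lm, where B = 1]) (auto simp: E_def X_def q_def indicator_def)
  have H_L2: "H \<in> L2 \<Omega>"
  proof (rule bounded_in_L2[OF lm, where B = "\<beta>\<^sub>j - \<alpha>\<^sub>j"])
    show "norm (H x) \<le> \<beta>\<^sub>j - \<alpha>\<^sub>j" for x
      using mult_mono[OF ramp_bounded[of \<alpha>\<^sub>j \<beta>\<^sub>j "x $ j"] q_bd[of "x $ k"]] assms
      by (simp add: H_def h_def abs_mult)
  qed simp
  \<comment> \<open>Up to sign, \<open>E\<close> is the rotation of \<open>H\<close>, and the mean value in question is \<open>\<integral> \<phi> \<bullet> E\<close>.\<close>
  define N where "N = L2_norm \<Omega> E + L2_norm \<Omega> H"
  have "L2_norm \<Omega> E \<ge> 0" "L2_norm \<Omega> H \<ge> 0"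
    by (auto simp: L2_norm_def)
  then have N0: "N \<ge> 0" by (simp add: N_def)
  have bound: "\<bar>\<integral>x. \<phi> x \<bullet> E x \<partial>lebesgue_on \<Omega>\<bar> \<le> \<epsilon> * N" if eps: "\<epsilon> > 0" for \<epsilon>
  proof -
    obtain \<theta> where \<theta>: "\<theta> \<in> test_fields \<Omega>" and less: "graph_norm \<Omega> (\<lambda>x. \<phi> x - \<theta> x) < \<epsilon>"
      using assms(5) eps by (auto simp: R_ring_0_def R_ring_def)
    define w where "w = weak_rot \<Omega> (\<lambda>x. \<phi> x - \<theta> x)"
    have "L2_norm \<Omega> (\<lambda>x. \<phi> x - \<theta> x) \<le> graph_norm \<Omega> (\<lambda>x. \<phi> x - \<theta> x)"
      "L2_norm \<Omega> w \<le> graph_norm \<Omega> (\<lambda>x. \<phi> x - \<theta> x)"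
      unfolding graph_norm_def w_def by (auto intro!: real_le_rsqrt)
    then have small: "L2_norm \<Omega> (\<lambda>x. \<phi> x - \<theta> x) \<le> \<epsilon>" "L2_norm \<Omega> (rot \<theta>) \<le> \<epsilon>"
      using less L2_norm_rot_le[OF assms(1,3,5) \<theta>] by (auto simp: w_def)
    note smooth_borel_measurable[OF test_fieldsD(1), OF \<theta>, measurable]
      smooth_borel_measurable[OF test_fieldsD(1)[OF rot_test_fields], OF \<theta>, measurable]
    have \<theta>_L2: "\<theta> \<in> L2 \<Omega>" and rot_L2: "rot \<theta> \<in> L2 \<Omega>"
      using \<theta> by (auto intro: test_fields_L2[OF lm] rot_test_fields)
    have diff_L2: "(\<lambda>x. \<phi> x - \<theta> x) \<in> L2 \<Omega>"
      by (rule L2_diff[OF \<phi> \<theta>_L2])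
    have "\<bar>\<integral>x. \<theta> x \<bullet> E x \<partial>lebesgue_on \<Omega>\<bar> = \<bar>\<integral>x. rot \<theta> x \<bullet> H x \<partial>lebesgue_on \<Omega>\<bar>"
    proof -
      have "(\<integral>x. \<theta> x \<bullet> E x \<partial>lebesgue_on \<Omega>) = (\<integral>x. \<theta> x \<bullet> E x \<partial>lborel)"
        using \<open>open \<Omega>\<close> test_fieldsD(4)[OF \<theta>] by (intro integral_lebesgue_on_eq_lborel) auto
      moreover have "(\<integral>x. rot \<theta> x \<bullet> H x \<partial>lebesgue_on \<Omega>) = (\<integral>x. rot \<theta> x \<bullet> H x \<partial>lborel)"
        using \<open>open \<Omega>\<close> test_fieldsD(4)[OF rot_test_fields[OF \<theta>]]
        by (intro integral_lebesgue_on_eq_lborel) auto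
      ultimately show ?thesis
        using integral_rot_ramp[OF test_fieldsD(1,2)[OF \<theta>] assms(6,8) q_meas q_bd]
        by (simp add: E_def H_def X_def h_def inner_axis mult_ac)
    qed
    also have "\<dots> \<le> L2_norm \<Omega> (rot \<theta>) * L2_norm \<Omega> H"
      by (rule L2_Cauchy_Schwarz[OF rot_L2 H_L2])
    also have "\<dots> \<le> \<epsilon> * L2_norm \<Omega> H"
      using small by (intro mult_right_mono) (auto simp: L2_norm_def)
    finally have 1: "\<bar>\<integral>x. \<theta> x \<bullet> E x \<partial>lebesgue_on \<Omega>\<bar> \<le> \<epsilon> * L2_norm \<Omega> H" .
    have "\<bar>\<integral>x. (\<phi> x - \<theta> x) \<bullet> E x \<partial>lebesgue_on \<Omega>\<bar> \<le> L2_norm \<Omega> (\<lambda>x. \<phi> x - \<theta> x) * L2_norm \<Omega> E"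
      by (rule L2_Cauchy_Schwarz[OF diff_L2 E_L2])
    also have "\<dots> \<le> \<epsilon> * L2_norm \<Omega> E"
      using small by (intro mult_right_mono) (auto simp: L2_norm_def)
    finally have 2: "\<bar>\<integral>x. (\<phi> x - \<theta> x) \<bullet> E x \<partial>lebesgue_on \<Omega>\<bar> \<le> \<epsilon> * L2_norm \<Omega> E" .
    have "(\<integral>x. (\<phi> x - \<theta> x) \<bullet> E x \<partial>lebesgue_on \<Omega>)
        = (\<integral>x. \<phi> x \<bullet> E x \<partial>lebesgue_on \<Omega>) - (\<integral>x. \<theta> x \<bullet> E x \<partial>lebesgue_on \<Omega>)"
      using \<phi> \<theta>_L2 E_L2 by (simp add: inner_diff_left L2_inner_integrable)
    then show ?thesis
      using 1 2 by (simp add: N_def distrib_left)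
  qed
  have "\<bar>\<integral>x. \<phi> x \<bullet> E x \<partial>lebesgue_on \<Omega>\<bar> \<le> e" if "e > 0" for e
  proof -
    have "e / (N + 1) * N \<le> e"
      using N0 that by (simp add: field_simps)
    then show ?thesis
      using bound[of "e / (N + 1)"] N0 that by simp
  qed
  then have zero: "(\<integral>x. \<phi> x \<bullet> E x \<partial>lebesgue_on \<Omega>) = 0"
    using field_le_epsilon[of "\<bar>\<integral>x. \<phi> x \<bullet> E x \<partial>lebesgue_on \<Omega>\<bar>" 0] by simp
  have "(\<integral>x. \<phi> x $ i \<partial>lebesgue_on \<omega>) = (\<integral>x. indicator \<omega> x *\<^sub>R (\<phi> x $ i) \<partial>lebesgue)"
    using \<omega>_sets by (subst integral_restrict_space) (auto simp: set_lebesgue_integral_def)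
  also have "\<dots> = (\<integral>x. indicator \<Omega> x *\<^sub>R (\<phi> x \<bullet> E x) \<partial>lebesgue)"
    by (intro Bochner_Integration.integral_cong)
      (auto simp: E_def X_def q_def \<omega>_def indicator_def inner_axis)
  also have "\<dots> = (\<integral>x. \<phi> x \<bullet> E x \<partial>lebesgue_on \<Omega>)"
    using \<open>open \<Omega>\<close> by (subst integral_restrict_space) (auto simp: set_lebesgue_integral_def)
  finally have "(\<integral>x. \<phi> x $ i \<partial>lebesgue_on \<omega>) = 0"
    using zero by simp
  moreover have "(\<lambda>x. \<phi> x $ i) \<in> L2 \<omega>"
    using lm \<omega>_sets by (intro L2_component_subset[OF \<phi>]) (auto simp: fmeasurableD)
  ultimately show ?thesis
    by (simp add: L2_mean_zero_def \<omega>_def)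
qed

end
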